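(* Let $m,n,\nu>0$, and let $X,Y$ be independent random variables with values in $\{0,1,2,\ldots\}$, with $\mathrm{P}(X=x)=f(x)>0$ and $\mathrm{P}(Y=y)=g(y)>0$ for all $x,y\in\{0,1,2,\ldots\}$. If, for all values of the sum $x+y$, the conditional distribution $\mathrm{P}(X=x\mid X+Y=x+y)$ is the COM-negative hypergeometric distribution with parameters $(z=x+y,\nu,m,n)$, then $X$ and $Y$ have the distributions $\mathrm{CMNB}(m,\nu,p)$ and $\mathrm{CMNB}(n,\nu,p)$, respectively, for some (common) $p$.
   Context: For $r,\nu\in(0,\infty)$ and $p\in(0,1)$, a random variable $X$ follows the COM-negative binomial distribution $\mathrm{CMNB}(r,\nu,p)$ if $$\mathrm{P}(X=k)=\left(\frac{\Gamma(r+k)}{k!\,\Gamma(r)}\right)^{\nu}p^k(1-p)^r\frac{1}{C(r,\nu,p)},\quad k=0,1,2,\ldots,\qquad C(r,\nu,p)=\sum_{i=0}^{\infty}\left(\frac{\Gamma(r+i)}{i!\,\Gamma(r)}\right)^{\nu}p^i(1-p)^r .$$ The COM-negative hypergeometric distribution with parameters $(z,\nu,m,n)$ has probability mass function $$\mathrm{P}(X=k)=\frac{1}{N(m,n,z,\nu)}\left(\binom{z}{k}\frac{\mathrm{B}(m+k,n+z-k)}{\mathrm{B}(m,n)}\right)^{\nu},\quad k=0,1,\ldots,z,$$ where $\mathrm{B}$ is the Beta function and $$N(m,n,z,\nu)=\sum_{x=0}^{z}\left(\binom{z}{x}\frac{\mathrm{B}(m+x,n+z-x)}{\mathrm{B}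(m,n)}\right)^{\nu}.$$
   Formalization: Adds the condition ν(1−m) ≤ 1 or ν(1−n) ≤ 1; without it the claim fails for p in (0,1): for m=n=1/2, ν=4, independent X,Y with P(X=k) proportional to (Γ(1/2+k)/(k!Γ(1/2)))^4 satisfy the hypothesis but correspond to p=1. *)

theory Defs
  imports "HOL-Probability.Probability"
begin

definition cmnb_const :: "real \<Rightarrow> real \<Rightarrow> real \<Rightarrow> real" where
  "cmnb_const r \<nu> p =
     (\<Sum>i. (Gamma (r + real i) / (fact i * Gamma r)) powr \<nu> * p ^ i * (1 - p) powr r)"

definition cmnb_pmf :: "real \<Rightarrow> real \<Rightarrow> real \<Rightarrow> nat \<Rightarrow> real" where
  "cmnb_pmf r \<nu> p k =
     (Gamma (r + real k) / (fact k * Gamma r)) powr \<nu> * p ^ k * (1 - p) powr r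
       * (1 / cmnb_const r \<nu> p)"

text \<open>
  The parameter domain \<open>p \<in> {0<..<1}\<close> (and \<open>r, \<nu> > 0\<close>) is part of the notion of a
  COM-negative binomial distribution, so it belongs to the predicate.
\<close>

definition CMNB :: "'a measure \<Rightarrow> ('a \<Rightarrow> nat) \<Rightarrow> real \<Rightarrow> real \<Rightarrow> real \<Rightarrow> bool" where
  "CMNB M X r \<nu> p \<longleftrightarrow> r > 0 \<and> \<nu> > 0 \<and> 0 < p \<and> p < 1 \<and>
     (\<forall>k. \<P>(\<omega> in M. X \<omega> = k) = cmnb_pmf r \<nu> p k)"

definition cmnh_const :: "real \<Rightarrow> real \<Rightarrow> nat \<Rightarrow> real \<Rightarrow> real" where
  "cmnh_const m n z \<nu> =
     (\<Sum>x\<le>z. (real (z choose x) * Beta (m + real x) (n + real z - real x) / Beta m n) powr \<nu>)"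

text \<open>Only meaningful for \<open>k \<le> z\<close>, the support of the COM-negative hypergeometric distribution.\<close>

definition cmnh_pmf :: "nat \<Rightarrow> real \<Rightarrow> real \<Rightarrow> real \<Rightarrow> nat \<Rightarrow> real" where
  "cmnh_pmf z \<nu> m n k =
     1 / cmnh_const m n z \<nu> *
       (real (z choose k) * Beta (m + real k) (n + real z - real k) / Beta m n) powr \<nu>"

text \<open>
  The characterization of the COM-negative binomial distribution needs the condition
  \<open>\<nu> * (1 - m) \<le> 1 \<or> \<nu> * (1 - n) \<le> 1\<close>.  By Stirling, the weights
  \<open>(Gamma (r + k) / (k! * Gamma r)) powr \<nu>\<close> behave like a multiple of
  \<open>k powr (- \<nu> * (1 - r))\<close>, so they are summable iff \<open>\<nu> * (1 - r) > 1\<close>.  If this holds for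
  both \<open>r = m\<close> and \<open>r = n\<close> (for instance \<open>m = n = 1/2\<close>, \<open>\<nu> = 4\<close>), then independent \<open>X\<close> and
  \<open>Y\<close> whose probabilities are the normalized weights have COM-negative hypergeometric
  conditional distributions, but correspond to \<open>p = 1\<close> and to no \<open>p < 1\<close>.
\<close>

end

theory Submission
  imports Defs
begin

text \<open>
  Writing \<open>a\<close> and \<open>b\<close> for the weights \<open>(Gamma (r + k) / (k! * Gamma r)) powr \<nu>\<close> with \<open>r = m\<close> and
  \<open>r = n\<close>, the COM-negative hypergeometric probability of \<open>x\<close> given the sum \<open>z = x + y\<close> is
  \<open>a x * b y\<close> times a factor depending on \<open>z\<close> only. Hence \<open>f x / a x * (g y / b y)\<close> depends only on
  \<open>x + y\<close>, which forces both factors to be geometric with a common ratio \<open>p\<close>. Since \<open>a k\<close> behaves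
  like a multiple of \<open>k powr (- \<nu> * (1 - m))\<close>, a ratio \<open>p \<ge> 1\<close> would contradict the divergence of
  the harmonic series if \<open>\<nu> * (1 - m) \<le> 1\<close>; the case \<open>\<nu> * (1 - n) \<le> 1\<close> is the same with \<open>b\<close>.
\<close>

definition cmnb_weight :: "real \<Rightarrow> real \<Rightarrow> nat \<Rightarrow> real" where
  "cmnb_weight r \<nu> k = (Gamma (r + real k) / (fact k * Gamma r)) powr \<nu>"

lemma cmnb_weight_pos:
  assumes "r > 0"
  shows "cmnb_weight r \<nu> k > 0"
proof -
  have "Gamma r > 0" "Gamma (r + real k) > 0"
    using assms by (auto intro!: add_pos_nonneg)
  then show ?thesis
    by (simp add: cmnb_weight_def)
qed

text \<open>In \<open>Beta u v = Gamma u * Gamma v / Gamma (u + v)\<close> the two arguments add up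
  to \<open>m + n + real (x + y)\<close>, so the denominator sees only the sum and the numerator
  splits into a factor in \<open>x\<close> and one in \<open>y\<close>.\<close>

lemma negative_hypergeometric_eq:
  fixes m n :: real
  assumes "m > 0" "n > 0"
  shows "real ((x + y) choose x) * Beta (m + real x) (n + real (x + y) - real x) / Beta m n =
    (fact (x + y) * Gamma (m + n) / Gamma (m + n + real (x + y))) *
    ((Gamma (m + real x) / (fact x * Gamma m)) * (Gamma (n + real y) / (fact y * Gamma n)))"
proof -
  have pos: "Gamma m > 0" "Gamma n > 0" "Gamma (m + n) > 0" "Gamma (m + n + real (x + y)) > 0"
    using assms by (auto intro!: add_pos_nonneg)
  have "real ((x + y) choose x) = fact (x + y) / (fact x * fact y)"
    by (simp add: binomial_fact)
  moreover have "m + real x + (n + real y) = m + n + real (x + y)"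
    by simp
  moreover have "n + real (x + y) - real x = n + real y"
    by simp
  ultimately show ?thesis
    using pos unfolding Beta_def by (simp add: field_simps)
qed

lemma cmnh_pmf_eq:
  assumes "m > 0" "n > 0"
  shows "cmnh_pmf (x + y) \<nu> m n x =
    1 / cmnh_const m n (x + y) \<nu> * (fact (x + y) * Gamma (m + n) / Gamma (m + n + real (x + y))) powr \<nu>
      * (cmnb_weight m \<nu> x * cmnb_weight n \<nu> y)"
  unfolding cmnh_pmf_def negative_hypergeometric_eq[OF assms] cmnb_weight_def
  by (simp add: powr_mult mult.assoc del: times_divide_eq_left times_divide_eq_right)

text \<open>Moving one unit from \<open>x\<close> to \<open>y\<close> keeps the sum, so
  \<open>F (Suc x) / F x = G (Suc y) / G y\<close> for all \<open>x\<close> and \<open>y\<close>.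
  Both ratios are therefore one constant.\<close>

lemma geometric_of_sum_dependent_product:
  fixes F G H :: "nat \<Rightarrow> real"
  assumes F: "\<And>x. F x > 0" and G: "\<And>y. G y > 0" and prod: "\<And>x y. F x * G y = H (x + y)"
  shows "\<exists>p>0. (\<forall>x. F x = F 0 * p ^ x) \<and> (\<forall>y. G y = G 0 * p ^ y)"
proof -
  define p where "p = F 1 / F 0"
  have swap: "F (Suc x) * G y = F x * G (Suc y)" for x y
    using prod[of "Suc x" y] prod[of x "Suc y"] by simp
  have G_step: "G (Suc y) = p * G y" for y
    using swap[of 0 y] F[of 0] by (simp add: p_def field_simps)
  have F_step: "F (Suc x) = p * F x" for x
    using swap[of x 0] G_step[of 0] G[of 0] by simp
  have "F x = F 0 * p ^ x" for x
    by (induction x) (simp_all add: F_step)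
  moreover have "G y = G 0 * p ^ y" for y
    by (induction y) (simp_all add: G_step)
  moreover have "p > 0"
    using F by (simp add: p_def)
  ultimately show ?thesis
    by blast
qed

text \<open>The base of the weight is the generalized binomial coefficient of
  \<open>r - 1 + k\<close> over \<open>k\<close>, whose growth \<open>Gamma_gbinomial\<close> gives.
  As the limit \<open>rGamma r\<close> is positive, the power \<nu> passes to the limit.\<close>

lemma cmnb_weight_asymp:
  assumes "r > 0"
  shows "(\<lambda>k. cmnb_weight r \<nu> k * real k powr (\<nu> * (1 - r))) \<longlonglongrightarrow> rGamma r powr \<nu>"
proof -
  have "(\<lambda>k. ((r - 1 + of_nat k) gchoose k) * exp (- (r - 1) * of_real (ln (of_nat k)))) \<longlonglongrightarrow> rGamma r"
    using Gamma_gbinomial[of "r - 1"] by simp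
  moreover have "rGamma r > 0"
    using Gamma_real_pos[OF assms] by (simp add: rGamma_inverse_Gamma)
  ultimately have "(\<lambda>k. (((r - 1 + of_nat k) gchoose k) * exp (- (r - 1) * of_real (ln (of_nat k)))) powr \<nu>)
      \<longlonglongrightarrow> rGamma r powr \<nu>"
    by (intro tendsto_intros) auto
  then show ?thesis
  proof (rule Lim_transform_eventually)
    \<comment> \<open>At \<open>k = 0\<close> the sides differ: \<open>ln 0 = 0\<close> makes the
      exponential 1, whereas \<open>0 powr\<close> is 0.\<close>
    have "(((r - 1 + of_nat k) gchoose k) * exp (- (r - 1) * of_real (ln (of_nat k)))) powr \<nu> =
        cmnb_weight r \<nu> k * real k powr (\<nu> * (1 - r))" if "k > 0" for k
    proof -
      have "(r - 1 + real k) gchoose k = pochhammer r k / fact k"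
        by (simp add: gbinomial_pochhammer' algebra_simps)
      also have "\<dots> = Gamma (r + real k) / (fact k * Gamma r)"
        using assms by (subst pochhammer_Gamma) (auto elim!: nonpos_Ints_cases)
      finally have eq: "(r - 1 + real k) gchoose k = Gamma (r + real k) / (fact k * Gamma r)" .
      have e: "exp (- (r - 1) * of_real (ln (of_nat k))) = real k powr (1 - r)"
        using that by (simp add: powr_def)
      show ?thesis
        unfolding eq e cmnb_weight_def powr_mult by (simp add: powr_powr mult.commute)
    qed
    then show "\<forall>\<^sub>F k in sequentially. (((r - 1 + of_nat k) gchoose k) *
        exp (- (r - 1) * of_real (ln (of_nat k)))) powr \<nu> = cmnb_weight r \<nu> k * real k powr (\<nu> * (1 - r))"
      using eventually_gt_at_top[of 0] by (rule eventually_mono[rotated])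
  qed
qed

lemma not_summable_cmnb_weight:
  assumes "r > 0" "\<nu> * (1 - r) \<le> 1" "p \<ge> 1"
  shows "\<not> summable (\<lambda>k. cmnb_weight r \<nu> k * p ^ k)"
proof
  assume sm: "summable (\<lambda>k. cmnb_weight r \<nu> k * p ^ k)"
  define c where "c = rGamma r powr \<nu>"
  have "c > 0"
    using Gamma_real_pos[OF assms(1)] by (simp add: c_def rGamma_inverse_Gamma)
  then have "\<forall>\<^sub>F k in sequentially. cmnb_weight r \<nu> k * real k powr (\<nu> * (1 - r)) > c / 2"
    by (intro order_tendstoD(1)[OF cmnb_weight_asymp[OF assms(1), of \<nu>, folded c_def]]) simp
  then have "\<forall>\<^sub>F k in sequentially. norm (inverse (real k)) \<le> 2 / c * (cmnb_weight r \<nu> k * p ^ k)"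
    using eventually_gt_at_top[of 0]
  proof eventually_elim
    case (elim k)
    have "c / 2 < cmnb_weight r \<nu> k * real k powr (\<nu> * (1 - r))"
      by fact
    \<comment> \<open>The hypothesis on the exponent enters here, with base \<open>real k\<close> at
      least 1; the terms then dominate a multiple of the harmonic series.\<close>
    also have "\<dots> \<le> cmnb_weight r \<nu> k * real k powr 1"
      using assms elim cmnb_weight_pos[of r \<nu> k] by (intro mult_left_mono powr_mono) auto
    also have "\<dots> \<le> (cmnb_weight r \<nu> k * p ^ k) * real k"
      using assms elim cmnb_weight_pos[of r \<nu> k] one_le_power[of p k]
      by (simp add: mult_le_cancel_left mult_le_cancel_right)
    finally show ?case
      using elim \<open>c > 0\<close> by (simp add: field_simps)
  qed
  then have "summable (\<lambda>k. inverse (real k))"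
    by (rule summable_comparison_test_ev) (intro summable_mult sm)
  then show False
    using not_summable_harmonic[where 'a=real] by simp
qed

lemma (in prob_space) sums_prob_singleton:
  assumes X[measurable]: "X \<in> measurable M (count_space (UNIV :: nat set))"
  shows "(\<lambda>k. \<P>(\<omega> in M. X \<omega> = k)) sums 1"
proof -
  have "(\<lambda>k. prob {\<omega> \<in> space M. X \<omega> = k}) sums prob (\<Union>k. {\<omega> \<in> space M. X \<omega> = k})"
    by (rule finite_measure_UNION) (auto simp: disjoint_family_on_def)
  also have "(\<Union>k. {\<omega> \<in> space M. X \<omega> = k}) = space M"
    by auto
  finally show ?thesis
    by (simp add: prob_space)
qed

text \<open>Total mass 1 determines \<open>c\<close>, and the factor \<open>(1 - p) powr r\<close>
  cancels against the same factor in \<open>cmnb_const\<close>.\<close>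

lemma cmnb_pmf_eqI:
  assumes f: "\<And>k. f k = c * (cmnb_weight r \<nu> k * p ^ k)" and "f sums 1" and "c > 0" and "p < 1"
  shows "f k = cmnb_pmf r \<nu> p k"
proof -
  define q where "q = (1 - p) powr r"
  have "q > 0"
    using assms by (simp add: q_def)
  have "(\<lambda>k. q / c * f k) sums (q / c * 1)"
    by (intro sums_mult assms)
  moreover have "q / c * f k = (Gamma (r + real k) / (fact k * Gamma r)) powr \<nu> * p ^ k * q" for k
    using \<open>c > 0\<close> by (simp add: f cmnb_weight_def)
  ultimately have "cmnb_const r \<nu> p = q / c"
    unfolding cmnb_const_def q_def[symmetric] by (simp add: sums_iff)
  then show ?thesis
    unfolding cmnb_pmf_def q_def[symmetric] f cmnb_weight_def[symmetric]
    using \<open>q > 0\<close> \<open>c > 0\<close> by simp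
qed

theorem theorem3p1:
  fixes M :: "'a measure" and X Y :: "'a \<Rightarrow> nat" and f g :: "nat \<Rightarrow> real"
    and m n \<nu> :: real
  assumes "prob_space M"
    and "m > 0" and "n > 0" and "\<nu> > 0"
    and "\<nu> * (1 - m) \<le> 1 \<or> \<nu> * (1 - n) \<le> 1"
    and "prob_space.indep_var M (count_space UNIV) X (count_space UNIV) Y"
    and "\<And>x. \<P>(\<omega> in M. X \<omega> = x) = f x" and "\<And>x. f x > 0"
    and "\<And>y. \<P>(\<omega> in M. Y \<omega> = y) = g y" and "\<And>y. g y > 0"
    and "\<And>x y. \<P>(\<omega> in M. X \<omega> = x \<bar> X \<omega> + Y \<omega> = x + y) = cmnh_pmf (x + y) \<nu> m n x"
  shows "\<exists>p. CMNB M X m \<nu> p \<and> CMNB M Y n \<nu> p"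
proof -
  interpret prob_space M by fact
  have X[measurable]: "X \<in> measurable M (count_space UNIV)"
    and Y[measurable]: "Y \<in> measurable M (count_space UNIV)"
    using indep_var_rv1[OF assms(6)] indep_var_rv2[OF assms(6)] by auto
  have joint: "\<P>(\<omega> in M. X \<omega> = x \<and> Y \<omega> = y) = f x * g y" for x y
  proof -
    have "prob ((\<lambda>\<omega>. (X \<omega>, Y \<omega>)) -` ({x} \<times> {y}) \<inter> space M) =
        prob (X -` {x} \<inter> space M) * prob (Y -` {y} \<inter> space M)"
      by (rule indep_varD[OF assms(6)]) auto
    then show ?thesis
      unfolding assms(7,9)[symmetric] by (simp add: vimage_def Int_def conj_commute)
  qed
  define a where "a = cmnb_weight m \<nu>"
  define b where "b = cmnb_weight n \<nu>"
  have a: "a k > 0" and b: "b k > 0" for k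
    using assms by (auto simp: a_def b_def cmnb_weight_pos)
  define s where "s z = \<P>(\<omega> in M. X \<omega> + Y \<omega> = z)" for z
  \<comment> \<open>\<open>H\<close> collects every factor that depends on the sum alone: its
    probability and the prefactor from \<open>cmnh_pmf_eq\<close>.\<close>
  define H where "H z = s z * (1 / cmnh_const m n z \<nu> *
    (fact z * Gamma (m + n) / Gamma (m + n + real z)) powr \<nu>)" for z
  have prod: "f x / a x * (g y / b y) = H (x + y)" for x y
  proof -
    \<comment> \<open>The conditioning event contains an event of positive probability, so the
      quotient in \<open>cond_prob\<close> is not a division by zero.\<close>
    have "f x * g y \<le> s (x + y)"
      unfolding joint[symmetric] s_def by (intro finite_measure_mono) auto
    then have "s (x + y) > 0"
      using assms(8)[of x] assms(10)[of y] by (smt (verit) mult_pos_pos)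
    have "{\<omega> \<in> space M. X \<omega> = x \<and> X \<omega> + Y \<omega> = x + y} = {\<omega> \<in> space M. X \<omega> = x \<and> Y \<omega> = y}"
      by auto
    then have "f x * g y / s (x + y) = cmnh_pmf (x + y) \<nu> m n x"
      using assms(11)[of x y] by (simp add: cond_prob_def s_def joint)
    then have "f x * g y = s (x + y) * cmnh_pmf (x + y) \<nu> m n x"
      using \<open>s (x + y) > 0\<close> by (simp add: field_simps)
    then have "f x * g y = H (x + y) * (a x * b y)"
      unfolding cmnh_pmf_eq[OF assms(2,3)] H_def a_def b_def by (simp only: mult.assoc)
    then show ?thesis
      using a[of x] b[of y] by (simp add: field_simps)
  qed
  obtain p where p: "p > 0" and "\<And>x. f x / a x = f 0 / a 0 * p ^ x"
    and "\<And>y. g y / b y = g 0 / b 0 * p ^ y"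
    using geometric_of_sum_dependent_product[of "\<lambda>x. f x / a x" "\<lambda>y. g y / b y" H] a b
      assms(8,10) prod by auto
  then have f: "f x = f 0 / a 0 * (a x * p ^ x)" and g: "g x = g 0 / b 0 * (b x * p ^ x)" for x
    using a[of x] b[of x] by (metis less_irrefl nonzero_divide_eq_eq mult.assoc mult.commute)+
  have f1: "f sums 1" and g1: "g sums 1"
    using sums_prob_singleton[OF X] sums_prob_singleton[OF Y] by (simp_all add: assms(7,9))
  have c: "f 0 / a 0 > 0" "g 0 / b 0 > 0"
    using a b assms(8,10) by auto
  \<comment> \<open>Both series are, up to positive constants, the total masses of \<open>f\<close>
    and \<open>g\<close>; whichever alternative of the hypothesis holds, one of them rules out
    \<open>p \<ge> 1\<close>.\<close>
  have "summable (\<lambda>x. a x * p ^ x)" "summable (\<lambda>x. b x * p ^ x)"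
    using sums_summable[OF iffD1[OF sums_cong[OF f] f1]] sums_summable[OF iffD1[OF sums_cong[OF g] g1]] c
    unfolding summable_cmult_iff by (metis less_irrefl)+
  then have "p < 1"
    using assms(2,3,5) not_summable_cmnb_weight[of m \<nu> p] not_summable_cmnb_weight[of n \<nu> p]
    unfolding a_def b_def by fastforce
  have "f k = cmnb_pmf m \<nu> p k" "g k = cmnb_pmf n \<nu> p k" for k
    using cmnb_pmf_eqI[OF f[unfolded a_def] f1 c(1)[unfolded a_def] \<open>p < 1\<close>]
      cmnb_pmf_eqI[OF g[unfolded b_def] g1 c(2)[unfolded b_def] \<open>p < 1\<close>] by auto
  then show ?thesis
    using assms(2,3,4,7,9) p \<open>p < 1\<close> by (auto simp: CMNB_def)
qed

end
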